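(* Let $P$ be the distribution of the binary random vector $X=(X_v)_{v\in V}$ of a discrete determinantal point process on a finite set $V$ with kernel $K$. Then $P$ is faithful to the bidirected graph $G_b(P)$ if and only if the independence model $\mathcal{J}(P)$ satisfies downward-stability.
   Context: Let $V$ be a finite set. A (discrete) determinantal point process (DPP) on $V$ with kernel $K$ is a random subset $Y$ of $V$ such that $\mathbb{P}(A\subseteq Y)=\det(K_A)$ for all non-empty $A\subseteq V$, where $K\in\mathbb{R}^{V\times V}$ is a (symmetric) positive definite matrix with all eigenvalues at most $1$, and $K_A$ is the principal submatrix of $K$ with rows and columns indexed by $A$. Equivalently, the DPP is the binary random vector $X=(X_v)_{v\in V}\in\{0,1\}^V$ with $X_v=1$ iff $v\in Y$. For $A\subseteq V$, $X_A=(X_v)_{v\in A}$. The independence model $\mathcal{J}(P)$ is the set of triples $\langle A,B\mid C\rangle$ of pairwise disjoint subsets of $V$ such that $X_A$ is conditionally independent of $X_B$ given $X_C$, written $A\perp\!\!\!\perp B\mid C$ (marginal independence if $C=\varnothing$; trivially true if $A$ or $B$ is empty). Downward-stability: for all distinct $i,j\in V$ and $C\subseteq V\setminus\{i,j\}$, if $i\perp\!\!\!\perp j\mid C$ then $i\perp\!\!\!\perp j\mid C\setminus\{k\}$ for every $k\in V\setminus\{i,j\}$. $G_b(P)$ is the bidirected graph (all edges bidirected; as a combinatorial object, a simple graph) with node set $V$ in which distinct nodes $i$ and $j$ are non-adjacent if and only if $K_{ij}=0$. For pairwise disjoint $A,B,C\subseteq V$ with $A,B$ non-empty, write $A\perp_b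 B\mid C$ if every path in $G_b(P)$ between a vertex of $A$ and a vertex of $B$ contains a vertex outside $A\cup B\cup C$. $P$ is faithful to $G_b(P)$ if for all such $A,B,C$: $A\perp_b B\mid C$ if and only if $A\perp\!\!\!\perp B\mid C$. *)

theory Defs
  imports
    "HOL-Probability.Probability"
    "HOL-Combinatorics.Permutations"
    "Graph_Theory.Graph_Theory"
begin

section \<open>Matrices indexed by a finite set\<close>

text \<open>
  A real \<open>V \<times> V\<close> matrix is a function \<open>K :: 'a \<Rightarrow> 'a \<Rightarrow> real\<close> of which only the entries with both
  indices in \<open>V\<close> matter; likewise for vectors. This allows principal submatrices on arbitrary
  subsets of \<open>V\<close>, which a matrix type with a type as index set does not.
\<close>

definition sym_on :: "'a set \<Rightarrow> ('a \<Rightarrow> 'a \<Rightarrow> real) \<Rightarrow> bool" where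
  "sym_on V K \<longleftrightarrow> (\<forall>i\<in>V. \<forall>j\<in>V. K i j = K j i)"

definition pos_def_on :: "'a set \<Rightarrow> ('a \<Rightarrow> 'a \<Rightarrow> real) \<Rightarrow> bool" where
  "pos_def_on V K \<longleftrightarrow> (\<forall>x. (\<exists>v\<in>V. x v \<noteq> 0) \<longrightarrow> 0 < (\<Sum>i\<in>V. \<Sum>j\<in>V. x i * K i j * x j))"

definition eigenvalue_on :: "'a set \<Rightarrow> ('a \<Rightarrow> 'a \<Rightarrow> real) \<Rightarrow> real \<Rightarrow> bool" where
  "eigenvalue_on V K l \<longleftrightarrow> (\<exists>x. (\<exists>v\<in>V. x v \<noteq> 0) \<and> (\<forall>i\<in>V. (\<Sum>j\<in>V. K i j * x j) = l * x i))"

text \<open>The determinant of the principal submatrix \<open>K\<^sub>A\<close>, by the Leibniz formula.\<close>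

definition principal_minor :: "('a \<Rightarrow> 'a \<Rightarrow> real) \<Rightarrow> 'a set \<Rightarrow> real" where
  "principal_minor K A = (\<Sum>p | p permutes A. of_int (sign p) * (\<Prod>i\<in>A. K i (p i)))"

text \<open>It agrees with the library determinant under every enumeration of \<open>A\<close> by a finite type.\<close>

lemma principal_minor_eq_det:
  fixes e :: "'n::finite \<Rightarrow> 'a"
  assumes e: "bij_betw e UNIV A"
  shows "principal_minor K A = Determinants.det (\<chi> i j. K (e i) (e j))"
proof -
  have inj: "inj e" and A: "e ` UNIV = A"
    using e by (auto simp: bij_betw_def)
  have e': "bij_betw (inv_into UNIV e) A UNIV"
    using e by (rule bij_betw_inv_into)
  have inj': "inj_on (inv_into UNIV e) A" and A': "inv_into UNIV e ` A = UNIV"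
    using e' by (auto simp: bij_betw_def)
  have "Determinants.det (\<chi> i j. K (e i) (e j)) =
      (\<Sum>p | p permutes UNIV. of_int (sign p) * (\<Prod>i\<in>UNIV. K (e i) (e (p i))))"
    by (simp add: Determinants.det_def)
  also have "\<dots> = principal_minor K A"
    unfolding principal_minor_def
  proof (rule sum.reindex_bij_witness
      [where j = "map_permutation UNIV e" and i = "map_permutation A (inv_into UNIV e)"])
    fix p :: "'n \<Rightarrow> 'n" assume p: "p \<in> {p. p permutes UNIV}"
    show "map_permutation A (inv_into UNIV e) (map_permutation UNIV e p) = p"
      by (rule map_permutation_compose_inv[OF e]) (use p inj in auto)
    show "map_permutation UNIV e p \<in> {p. p permutes A}"
      using map_permutation_permutes[OF e] p by auto
    have "(\<Prod>i\<in>A. K i (map_permutation UNIV e p i)) = (\<Prod>i\<in>UNIV. K (e i) (e (p i)))"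
      using prod.reindex_bij_betw[OF e, of "\<lambda>i. K i (map_permutation UNIV e p i)", symmetric]
      by (simp add: map_permutation_apply inj)
    then show "of_int (sign (map_permutation UNIV e p)) * (\<Prod>i\<in>A. K i (map_permutation UNIV e p i))
        = of_int (sign p) * (\<Prod>i\<in>UNIV. K (e i) (e (p i)))"
      using p sign_map_permutation[OF inj, of p] by auto
  next
    fix p assume p: "p \<in> {p. p permutes A}"
    show "map_permutation UNIV e (map_permutation A (inv_into UNIV e) p) = p"
      by (rule map_permutation_compose_inv[OF e']) (use p e in \<open>auto simp: bij_betw_inv_into_right\<close>)
    show "map_permutation A (inv_into UNIV e) p \<in> {p. p permutes UNIV}"
      using map_permutation_permutes[OF e'] p by auto
  qed
  finally show ?thesis ..
qed

section \<open>Discrete determinantal point processes\<close>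

locale determinantal_process = prob_space M
  for M :: "'w measure" and V :: "'a set" and K :: "'a \<Rightarrow> 'a \<Rightarrow> real" and Y :: "'w \<Rightarrow> 'a set" +
  assumes finite_ground: "finite V"
    and kernel_sym: "sym_on V K"
    and kernel_pos_def: "pos_def_on V K"
    and kernel_eigenvalue_le_1: "\<And>l. eigenvalue_on V K l \<Longrightarrow> l \<le> 1"
    and random_subset: "random_variable (count_space (Pow V)) Y"
    and inclusion_prob:
      "\<And>A. A \<subseteq> V \<Longrightarrow> A \<noteq> {} \<Longrightarrow> \<P>(w in M. A \<subseteq> Y w) = principal_minor K A"

definition binary_vector :: "'a set \<Rightarrow> 'a set \<Rightarrow> 'a \<Rightarrow> nat" where
  "binary_vector V S = (\<lambda>v\<in>V. if v \<in> S then 1 else 0)"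

definition binary_distr :: "'w measure \<Rightarrow> 'a set \<Rightarrow> ('w \<Rightarrow> 'a set) \<Rightarrow> ('a \<Rightarrow> nat) measure" where
  "binary_distr M V Y = distr M (count_space (V \<rightarrow>\<^sub>E {0, 1})) (\<lambda>w. binary_vector V (Y w))"

section \<open>Independence models\<close>

text \<open>
  The subvector \<open>X\<^sub>A\<close> is \<open>restrict X A\<close>, taken on the space of \<open>P\<close> itself. Comparing the laws of
  subvectors value by value is adequate since the vectors here have finitely many values. Values
  \<open>a\<close> and \<open>b\<close> outside the range of the subvectors give \<open>0 = 0\<close>. For empty \<open>C\<close> the conditioning event
  is the whole space, and this is marginal independence.
\<close>

definition cond_indep ::
    "('a \<Rightarrow> nat) measure \<Rightarrow> 'a set \<Rightarrow> 'a set \<Rightarrow> 'a set \<Rightarrow> bool" where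
  "cond_indep P A B C \<longleftrightarrow>
    (\<forall>a b c. \<P>(x in P. restrict x C = c) > 0 \<longrightarrow>
      \<P>(x in P. restrict x A = a \<and> restrict x B = b \<bar> restrict x C = c) =
      \<P>(x in P. restrict x A = a \<bar> restrict x C = c) *
      \<P>(x in P. restrict x B = b \<bar> restrict x C = c))"

definition disjoint_triples :: "'a set \<Rightarrow> ('a set \<times> 'a set \<times> 'a set) set" where
  "disjoint_triples V = {(A, B, C). A \<subseteq> V \<and> B \<subseteq> V \<and> C \<subseteq> V \<and>
     A \<inter> B = {} \<and> A \<inter> C = {} \<and> B \<inter> C = {}}"

definition indep_model ::
    "'a set \<Rightarrow> ('a \<Rightarrow> nat) measure \<Rightarrow> ('a set \<times> 'a set \<times> 'a set) set" where
  "indep_model V P = {(A, B, C) \<in> disjoint_triples V. cond_indep P A B C}"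

definition downward_stable :: "'a set \<Rightarrow> ('a set \<times> 'a set \<times> 'a set) set \<Rightarrow> bool" where
  "downward_stable V J \<longleftrightarrow>
    (\<forall>i\<in>V. \<forall>j\<in>V. \<forall>C. i \<noteq> j \<longrightarrow> C \<subseteq> V - {i, j} \<longrightarrow> ({i}, {j}, C) \<in> J \<longrightarrow>
      (\<forall>k\<in>V - {i, j}. ({i}, {j}, C - {k}) \<in> J))"

section \<open>The bidirected graph\<close>

text \<open>
  As a combinatorial object this is a simple graph, which \<open>Graph_Theory\<close> represents by a symmetric
  loop-free set of pairs.
\<close>

definition bidirected_graph :: "'a set \<Rightarrow> ('a \<Rightarrow> 'a \<Rightarrow> real) \<Rightarrow> 'a pair_pre_digraph" where
  "bidirected_graph V K =
    \<lparr> pverts = V, parcs = {(i, j). i \<in> V \<and> j \<in> V \<and> i \<noteq> j \<and> K i j \<noteq> 0} \<rparr>"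

lemma (in determinantal_process) pair_graph_bidirected_graph:
  "pair_graph (bidirected_graph V K)"
proof -
  have "{(i, j). i \<in> V \<and> j \<in> V \<and> i \<noteq> j \<and> K i j \<noteq> 0} \<subseteq> V \<times> V"
    by auto
  then have "finite {(i, j). i \<in> V \<and> j \<in> V \<and> i \<noteq> j \<and> K i j \<noteq> 0}"
    using finite_ground by (meson finite_SigmaI finite_subset)
  then show ?thesis
    using finite_ground kernel_sym
    by unfold_locales
      (auto simp: bidirected_graph_def sym_on_def symmetric_def sym_def)
qed

definition separated ::
    "'a pair_pre_digraph \<Rightarrow> 'a set \<Rightarrow> 'a set \<Rightarrow> 'a set \<Rightarrow> bool" where
  "separated G A B C \<longleftrightarrow>
    (\<forall>p. vpath p (with_proj G) \<and> hd p \<in> A \<and> last p \<in> B \<longrightarrow> (\<exists>v\<in>set p. v \<notin> A \<union> B \<union> C))"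

definition faithful :: "'a set \<Rightarrow> ('a \<Rightarrow> nat) measure \<Rightarrow> 'a pair_pre_digraph \<Rightarrow> bool" where
  "faithful V P G \<longleftrightarrow>
    (\<forall>(A, B, C) \<in> disjoint_triples V. A \<noteq> {} \<longrightarrow> B \<noteq> {} \<longrightarrow>
      (separated G A B C \<longleftrightarrow> (A, B, C) \<in> indep_model V P))"

end

theory Submission
  imports Defs
begin

text \<open>
  Graphical separation always implies conditional independence: it splits \<open>A \<union> B \<union> C\<close> into two blocks
  between which \<open>K\<close> vanishes, so the inclusion probabilities factorise, and by the \<open>\<pi>\<close>-\<open>\<lambda>\<close> theorem
  the two blocks are independent. For the converse, a shortest violating path \<open>v\<^sub>0, \<dots>, v\<^sub>n\<close> is chordless
  with interior \<open>D \<subseteq> C\<close>, and downward-stability yields \<open>v\<^sub>0 \<bottom> v\<^sub>n | D\<close>. Evaluating this at the all-ones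
  vector gives a quadratic relation between minors of the tridiagonal matrix along the path; the
  defect in that relation is the product of the squared off-diagonal entries, which is nonzero.
\<close>

section \<open>Principal minors of block triangular and tridiagonal matrices\<close>

lemma principal_minor_empty [simp]: "principal_minor K {} = 1"
  by (simp add: principal_minor_def)

lemma principal_minor_singleton [simp]: "principal_minor K {v} = K v v"
  by (simp add: principal_minor_def)

text \<open>A permutation with nonzero Leibniz term sends no element of \<open>S\<close> into
  \<open>T\<close>. By finiteness it then maps \<open>S\<close> onto \<open>S\<close>, and hence
  \<open>T\<close> onto \<open>T\<close>. Such permutations correspond to pairs of a permutation of
  \<open>S\<close> and one of \<open>T\<close>, by restriction and composition, and sign and product
  are multiplicative.\<close>

lemma principal_minor_block_triangular:
  assumes fin: "finite S" "finite T" and disj: "S \<inter> T = {}"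
    and zero: "\<And>i j. i \<in> S \<Longrightarrow> j \<in> T \<Longrightarrow> K i j = 0"
  shows "principal_minor K (S \<union> T) = principal_minor K S * principal_minor K T"
proof -
  let ?f = "\<lambda>A p. of_int (sign p) * (\<Prod>i\<in>A. K i (p i)) :: real"
  let ?R = "{r. r permutes S \<union> T \<and> r ` S \<subseteq> S}"
  have "principal_minor K (S \<union> T) = (\<Sum>r\<in>?R. ?f (S \<union> T) r)"
    unfolding principal_minor_def
  proof (rule sum.mono_neutral_right)
    show "\<forall>r\<in>{r. r permutes S \<union> T} - ?R. ?f (S \<union> T) r = 0"
    proof
      fix r assume r: "r \<in> {r. r permutes S \<union> T} - ?R"
      then obtain i where i: "i \<in> S" "r i \<notin> S" by auto
      have "r i \<in> S \<union> T" using r i permutes_in_image[of r "S \<union> T" i] by auto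
      then have "K i (r i) = 0" using i zero by auto
      then have "(\<Prod>i\<in>S \<union> T. K i (r i)) = 0"
        using i fin by (intro prod_zero) auto
      then show "?f (S \<union> T) r = 0" by simp
    qed
  qed (use fin in \<open>auto simp: finite_permutations\<close>)
  also have "\<dots> = (\<Sum>(p, q)\<in>{p. p permutes S} \<times> {q. q permutes T}. ?f S p * ?f T q)"
  proof (rule sum.reindex_bij_witness
      [where j = "\<lambda>r. (restrict_id r S, restrict_id r T)" and i = "\<lambda>(p, q). p \<circ> q"])
    fix r assume "r \<in> ?R"
    then have r: "r permutes S \<union> T" and rS: "r ` S \<subseteq> S" by auto
    have inj: "inj r" using r by (rule permutes_inj)
    have S: "r ` S = S"
      using rS fin inj by (metis endo_inj_surj inj_on_subset subset_UNIV)
    have "r ` (S \<union> T) = S \<union> T" using r by (rule permutes_image)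
    moreover have "r ` (S \<union> T) = r ` S \<union> r ` T" and "r ` S \<inter> r ` T = {}"
      using disj image_Int[OF inj, of S T] by (simp_all add: image_Un)
    ultimately have "S \<union> r ` T = S \<union> T" "S \<inter> r ` T = {}" using S by simp_all
    then have T: "r ` T = T" using disj by auto
    note inj_r = inj_on_subset[OF inj subset_UNIV]
    have pS: "restrict_id r S permutes S" and pT: "restrict_id r T permutes T"
      using S T inj_r by (auto intro!: permutes_restrict_id simp: bij_betw_def)
    have "restrict_id r S (restrict_id r T x) = r x" for x
    proof -
      have "r x \<notin> S" if "x \<in> T" using that T disj by auto
      moreover have "r x = x" if "x \<notin> S" "x \<notin> T" using that r by (auto simp: permutes_not_in)
      ultimately show ?thesis using disj by (auto simp: restrict_id_def)
    qed
    then show comp: "(case (restrict_id r S, restrict_id r T) of (p, q) \<Rightarrow> p \<circ> q) = r"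
      by (simp add: fun_eq_iff)
    show "(restrict_id r S, restrict_id r T) \<in> {p. p permutes S} \<times> {q. q permutes T}"
      using pS pT by simp
    have "sign r = sign (restrict_id r S) * sign (restrict_id r T)"
      using sign_compose[of "restrict_id r S" "restrict_id r T"] comp pS pT fin
      by (simp add: permutes_imp_permutation)
    moreover have "(\<Prod>i\<in>S \<union> T. K i (r i))
        = (\<Prod>i\<in>S. K i (restrict_id r S i)) * (\<Prod>i\<in>T. K i (restrict_id r T i))"
      using fin disj by (subst prod.union_disjoint) auto
    ultimately show "(case (restrict_id r S, restrict_id r T) of (p, q) \<Rightarrow> ?f S p * ?f T q)
        = ?f (S \<union> T) r"
      by simp
  next
    fix pq assume "pq \<in> {p. p permutes S} \<times> {q. q permutes T}"
    then obtain p q where pq: "pq = (p, q)" "p permutes S" "q permutes T" by auto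
    have qS: "q x = x" if "x \<in> S" for x using that pq disj by (auto intro: permutes_not_in)
    have "p (q x) = q x" if "x \<in> T" for x
      using that pq disj permutes_in_image[of q T x] by (auto intro: permutes_not_in)
    moreover have "p x = x" if "x \<notin> S" for x
      using that pq by (auto intro: permutes_not_in)
    moreover have "q x = x" if "x \<notin> T" for x
      using that pq by (auto intro: permutes_not_in)
    ultimately show "(\<lambda>r. (restrict_id r S, restrict_id r T)) (case pq of (p, q) \<Rightarrow> p \<circ> q) = pq"
      using qS by (auto simp: pq(1) restrict_id_def fun_eq_iff)
    show "(case pq of (p, q) \<Rightarrow> p \<circ> q) \<in> ?R"
      using pq qS permutes_subset[of p S "S \<union> T"] permutes_subset[of q T "S \<union> T"]
      by (auto simp: permutes_in_image intro: permutes_compose)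
  qed
  also have "\<dots> = principal_minor K S * principal_minor K T"
    unfolding principal_minor_def by (simp add: sum_product sum.cartesian_product)
  finally show ?thesis .
qed

text \<open>Only permutations fixing \<open>v\<close> or swapping it with \<open>u\<close> contribute.\<close>

lemma principal_minor_insert_pendant:
  assumes fin: "finite R" and v: "v \<notin> insert u R" and u: "u \<notin> R"
    and zero: "\<And>i. i \<in> R \<Longrightarrow> K v i = 0" "\<And>i. i \<in> R \<Longrightarrow> K i v = 0"
  shows "principal_minor K (insert v (insert u R)) =
    K v v * principal_minor K (insert u R) - K v u * K u v * principal_minor K R"
proof -
  let ?S = "insert u R"
  let ?f = "\<lambda>A p. of_int (sign p) * (\<Prod>i\<in>A. K i (p i)) :: real"
  \<comment> \<open>Each permutation of the enlarged set is a transposition of \<open>v\<close> and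
    \<open>b\<close> after some \<open>q\<close> that fixes \<open>v\<close>. It sends
    \<open>v\<close> to \<open>b\<close>, so row \<open>v\<close> contributes the factor
    \<open>K v b\<close>.\<close>
  have split: "?f (insert v ?S) (Transposition.transpose v b \<circ> q) = of_int (sign (Transposition.transpose v b)) * K v b *
      (of_int (sign q) * (\<Prod>i\<in>?S. K i (Transposition.transpose v b (q i))))" if q: "q permutes ?S" for b q
  proof -
    have "q v = v" using q v by (auto intro: permutes_not_in)
    moreover have "sign (Transposition.transpose v b \<circ> q) = sign (Transposition.transpose v b) * sign q"
      using q fin by (auto intro!: sign_compose permutation_swap_id permutes_imp_permutation[of ?S])
    ultimately show ?thesis using v fin by (simp add: prod.insert)
  qed
  define g where "g b = (\<Sum>q | q permutes ?S. ?f (insert v ?S) (Transposition.transpose v b \<circ> q))" for b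
  have g: "g b = of_int (sign (Transposition.transpose v b)) * K v b *
      (\<Sum>q | q permutes ?S. of_int (sign q) * (\<Prod>i\<in>?S. K i (Transposition.transpose v b (q i))))" for b
    unfolding g_def sum_distrib_left by (rule sum.cong) (simp_all only: split mem_Collect_eq)
  have "principal_minor K (insert v ?S) = (\<Sum>b\<in>insert v ?S. g b)"
    unfolding principal_minor_def g_def using fin v
    by (subst sum_over_permutations_insert) auto
  \<comment> \<open>For \<open>b\<close> in \<open>R\<close> the factor \<open>K v b\<close>
    vanishes.\<close>
  also have "\<dots> = (\<Sum>b\<in>{v, u}. g b)"
    by (rule sum.mono_neutral_right) (use fin zero in \<open>auto simp: g\<close>)
  also have "\<dots> = g v + g u"
    using v by auto
  also have "g v = K v v * principal_minor K ?S"
    by (simp add: g principal_minor_def)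
  also have "g u = - K v u * (\<Sum>q | q permutes ?S. of_int (sign q) *
      (\<Prod>i\<in>?S. K i (Transposition.transpose v u (q i))))"
    using v by (simp add: g sign_swap_id)
  also have "(\<Sum>q | q permutes ?S. of_int (sign q) * (\<Prod>i\<in>?S. K i (Transposition.transpose v u (q i))))
      = (\<Sum>q | q permutes R. of_int (sign q) * (\<Prod>i\<in>?S. K i (Transposition.transpose v u (q i))))"
  proof (rule sum.mono_neutral_right)
    \<comment> \<open>If \<open>q\<close> moves \<open>u\<close>, the preimage \<open>i\<close> of
      \<open>u\<close> lies in \<open>R\<close>. The transposition carries \<open>u\<close> on to
      \<open>v\<close>, which produces the zero factor \<open>K i v\<close>.\<close>
    show "\<forall>q\<in>{q. q permutes ?S} - {q. q permutes R}.
        of_int (sign q) * (\<Prod>i\<in>?S. K i (Transposition.transpose v u (q i))) = 0"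
    proof
      fix q assume "q \<in> {q. q permutes ?S} - {q. q permutes R}"
      then have q: "q permutes ?S" and nq: "\<not> q permutes R" by auto
      have "q u \<noteq> u" using nq permutes_superset[OF q, of R] by auto
      obtain i where i: "q i = u" using q by (meson permutes_def)
      then have "i \<in> ?S" using permutes_in_image[OF q, of i] by auto
      with i \<open>q u \<noteq> u\<close> have "i \<in> R" by auto
      then have "(\<Prod>i\<in>?S. K i (Transposition.transpose v u (q i))) = 0"
        using fin i zero by (intro prod_zero bexI[of _ i]) auto
      then show "of_int (sign q) * (\<Prod>i\<in>?S. K i (Transposition.transpose v u (q i))) = 0" by simp
    qed
  qed (use fin in \<open>auto simp: finite_permutations intro: permutes_imp_permutes_insert\<close>)
  also have "\<dots> = K u v * principal_minor K R"
    unfolding principal_minor_def sum_distrib_left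
  proof (rule sum.cong)
    fix q assume "q \<in> {q. q permutes R}"
    then have q: "q permutes R" by simp
    have "q u = u" using q u by (auto intro: permutes_not_in)
    moreover have "(\<Prod>i\<in>R. K i (Transposition.transpose v u (q i))) = (\<Prod>i\<in>R. K i (q i))"
      using permutes_in_image[OF q] u v
      by (intro prod.cong refl) (metis insertCI transpose_apply_other)
    ultimately show "of_int (sign q) * (\<Prod>i\<in>?S. K i (Transposition.transpose v u (q i)))
        = K u v * (of_int (sign q) * (\<Prod>i\<in>R. K i (q i)))"
      using fin u by simp
  qed simp
  finally show ?thesis by simp
qed

text \<open>
  For a tridiagonal matrix, the product of the off-diagonal entries is the minor omitting the first
  column and the last row. This is the Desnanot-Jacobi identity in that case, and it follows from
  the three-term recurrence of continuants.
\<close>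

lemma principal_minor_tridiagonal:
  fixes w :: "nat \<Rightarrow> 'a"
  assumes inj: "inj_on w {..n}" and n: "1 \<le> n"
    and tri: "\<And>i j. i + 1 < j \<Longrightarrow> j \<le> n \<Longrightarrow> K (w i) (w j) = 0 \<and> K (w j) (w i) = 0"
  shows "principal_minor K (w ` {0..<Suc n}) * principal_minor K (w ` {1..<n})
    - principal_minor K (w ` {0..<n}) * principal_minor K (w ` {1..<Suc n})
    = - (\<Prod>i<n. K (w i) (w (Suc i)) * K (w (Suc i)) (w i))"
proof -
  \<comment> \<open>Half-open intervals make \<open>d i i\<close> the empty minor 1, so the
    recurrence already holds for the first 2 by 2 block, and \<open>n = 1\<close> (empty interior)
    needs no separate treatment.\<close>
  define d where "d i j = principal_minor K (w ` {i..<j})" for i j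
  define b where "b i = K (w i) (w (Suc i)) * K (w (Suc i)) (w i)" for i
  have rec: "d i (Suc (Suc m)) = K (w (Suc m)) (w (Suc m)) * d i (Suc m) - b m * d i m"
    if "i \<le> m" "Suc m \<le> n" for i m
  proof -
    have "principal_minor K (insert (w (Suc m)) (insert (w m) (w ` {i..<m}))) =
      K (w (Suc m)) (w (Suc m)) * principal_minor K (insert (w m) (w ` {i..<m}))
      - K (w (Suc m)) (w m) * K (w m) (w (Suc m)) * principal_minor K (w ` {i..<m})"
    proof (rule principal_minor_insert_pendant)
      show "w (Suc m) \<notin> insert (w m) (w ` {i..<m})" "w m \<notin> w ` {i..<m}"
        using inj that inj_on_image_mem_iff[OF inj, of "Suc m" "{i..<m}"]
          inj_on_image_mem_iff[OF inj, of m "{i..<m}"]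
          inj_on_eq_iff[OF inj, of "Suc m" m] by (auto simp: subset_iff)
    qed (use tri[of _ "Suc m"] that in auto)
    moreover have "insert (w m) (w ` {i..<m}) = w ` {i..<Suc m}"
      and "insert (w (Suc m)) (w ` {i..<Suc m}) = w ` {i..<Suc (Suc m)}"
      using that by (auto simp: atLeastLessThanSuc)
    ultimately show ?thesis by (simp add: d_def b_def)
  qed
  have "d 0 (Suc m) * d 1 m - d 0 m * d 1 (Suc m) = - (\<Prod>i<m. b i)" if "1 \<le> m" "m \<le> n" for m
    using that
  proof (induction m rule: dec_induct)
    case base
    have "d 0 1 = K (w 0) (w 0)" "d 1 2 = K (w 1) (w 1)" "d 0 0 = 1" "d 1 1 = 1"
      by (simp_all add: d_def numeral_2_eq_2)
    then show ?case using rec[of 0 0] n by (simp add: numeral_2_eq_2)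
  next
    \<comment> \<open>Expanding both minors that end at index \<open>Suc m\<close>, the terms with
      the diagonal entry cancel. What remains is the previous defect times
      \<open>b m\<close>.\<close>
    case (step m)
    have "d 0 (Suc (Suc m)) * d 1 (Suc m) - d 0 (Suc m) * d 1 (Suc (Suc m))
      = b m * (d 0 (Suc m) * d 1 m - d 0 m * d 1 (Suc m))"
      using step by (simp add: rec algebra_simps)
    then show ?case using step by simp
  qed
  from this[of n] n show ?thesis by (simp add: d_def b_def)
qed

section \<open>Separation and paths in the bidirected graph\<close>

lemma bidirected_graph_simps [simp]:
  "pverts (bidirected_graph V K) = V"
  "parcs (bidirected_graph V K) = {(i, j). i \<in> V \<and> j \<in> V \<and> i \<noteq> j \<and> K i j \<noteq> 0}"
  by (simp_all add: bidirected_graph_def)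

text \<open>The block \<open>W\<close> consists of the vertices that walks inside
  \<open>A \<union> B \<union> C\<close> reach from \<open>A\<close>. An edge leaving
  \<open>W\<close> within this union would extend such a walk, and reaching \<open>B\<close> would
  contradict separation.\<close>

lemma separated_block:
  assumes sep: "separated (bidirected_graph V K) A B C" and sub: "A \<union> B \<union> C \<subseteq> V"
    and disj: "A \<inter> B = {}"
  obtains W where "A \<subseteq> W" "W \<subseteq> A \<union> B \<union> C" "W \<inter> B = {}"
    "\<And>i j. i \<in> W \<Longrightarrow> j \<in> A \<union> B \<union> C - W \<Longrightarrow> K i j = 0"
proof
  let ?G = "with_proj (bidirected_graph V K)" and ?U = "A \<union> B \<union> C"
  define W where "W = {v. \<exists>p. vwalk p ?G \<and> hd p \<in> A \<and> last p = v \<and> set p \<subseteq> ?U}"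
  have "a \<in> W" if "a \<in> A" for a
    unfolding W_def using that sub by (intro CollectI exI[of _ "[a]"]) auto
  then show "A \<subseteq> W" by blast
  show "W \<subseteq> ?U"
    unfolding W_def using last_in_set by (fastforce simp: vwalk_def)
  show "W \<inter> B = {}"
  proof (rule ccontr)
    assume "W \<inter> B \<noteq> {}"
    then obtain p where p: "vwalk p ?G" "hd p \<in> A" "last p \<in> B" "set p \<subseteq> ?U"
      unfolding W_def by blast
    \<comment> \<open>\<open>W\<close> is defined by walks but \<open>separated\<close> speaks of
      paths. Removing loops keeps both ends and introduces no new vertices.\<close>
    have "vpath (vwalk_to_vpath p) ?G" using p(1) by (rule vwalk_to_vpath_vpath)
    moreover have "set (vwalk_to_vpath p) \<subseteq> ?U"
      using p(4) vwalk_to_vpath_subset by fast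
    moreover have "hd (vwalk_to_vpath p) \<in> A" "last (vwalk_to_vpath p) \<in> B"
      using p by (simp_all add: vwalk_to_vpath_hd vwalk_to_vpath_last)
    ultimately show False
      using sep unfolding separated_def by blast
  qed
  fix i j assume i: "i \<in> W" and j: "j \<in> ?U - W"
  then obtain p where p: "vwalk p ?G" "hd p \<in> A" "last p = i" "set p \<subseteq> ?U"
    unfolding W_def by blast
  have "p \<noteq> []" using p by auto
  show "K i j = 0"
  proof (rule ccontr)
    assume nz: "K i j \<noteq> 0"
    have "i \<in> V" "j \<in> V" "i \<noteq> j" using i j \<open>W \<subseteq> ?U\<close> sub by auto
    then have "vwalk (p @ [j]) ?G"
      using p nz \<open>p \<noteq> []\<close> by (auto simp: vwalk_def set_vwalk_arcs_snoc)
    then have "j \<in> W"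
      unfolding W_def using p j \<open>p \<noteq> []\<close> by (intro CollectI exI[of _ "p @ [j]"]) auto
    with j show False by simp
  qed
qed

text \<open>This is the shortcut along a chord: the part of the walk strictly between positions
  \<open>i\<close> and \<open>j\<close> is replaced by the single arc joining them.\<close>

lemma vwalk_take_drop:
  assumes p: "vwalk p G" and i: "i < length p" and j: "j < length p"
    and arc: "(p ! i, p ! j) \<in> arcs_ends G"
  shows "vwalk (take (Suc i) p @ drop j p) G"
proof -
  have "set (vwalk_arcs (take (Suc i) p)) \<subseteq> set (vwalk_arcs p)"
    using set_vwalk_arcs_append1[of "take (Suc i) p" "drop (Suc i) p"] by simp
  moreover have "set (vwalk_arcs (drop j p)) \<subseteq> set (vwalk_arcs p)"
    using set_vwalk_arcs_append2[of "drop j p" "take j p"] by simp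
  moreover have "take (Suc i) p \<noteq> []" "drop j p \<noteq> []" "last (take (Suc i) p) = p ! i"
    "hd (drop j p) = p ! j"
    using i j by (auto simp: hd_drop_conv_nth take_Suc_conv_app_nth)
  ultimately have "set (vwalk_arcs (take (Suc i) p @ drop j p)) \<subseteq> arcs_ends G"
    using p arc by (auto simp: vwalk_arcs_append vwalk_def)
  then show ?thesis
    using p \<open>drop j p \<noteq> []\<close> set_take_subset[of "Suc i" p] set_drop_subset[of j p]
    by (auto simp: vwalk_def)
qed

lemma vwalk_nth_arc:
  assumes "vwalk p G" "Suc i < length p"
  shows "(p ! i, p ! Suc i) \<in> arcs_ends G"
  using assms
proof (induction p arbitrary: i rule: vwalk_induct)
  case (Cons u v p)
  then show ?case by (cases i) auto
qed simp

text \<open>Any violation of the claimed properties would allow a shortest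
  separation-violating path to be cut short.\<close>

lemma not_separated_chordless_path:
  assumes nsep: "\<not> separated (bidirected_graph V K) A B C" and disj: "A \<inter> B = {}"
  obtains w :: "nat \<Rightarrow> 'a" and n where "1 \<le> n" "inj_on w {..n}" "w ` {..n} \<subseteq> V" "w 0 \<in> A" "w n \<in> B"
    "w ` {1..<n} \<subseteq> C" "\<And>i. i < n \<Longrightarrow> K (w i) (w (Suc i)) \<noteq> 0"
    "\<And>i j. i + 1 < j \<Longrightarrow> j \<le> n \<Longrightarrow> K (w i) (w j) = 0"
proof -
  let ?G = "with_proj (bidirected_graph V K)" and ?U = "A \<union> B \<union> C"
  \<comment> \<open>\<open>Q\<close> describes the witnesses of non-separation. Below,
    \<open>p\<close> is one with the fewest vertices, and \<open>n\<close> is its number of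
    edges.\<close>
  define Q where "Q p \<longleftrightarrow> vpath p ?G \<and> hd p \<in> A \<and> last p \<in> B \<and> set p \<subseteq> ?U" for p
  have "\<exists>p. Q p" using nsep by (auto simp: separated_def Q_def)
  then obtain p where p: "Q p" and min: "\<And>q. Q q \<Longrightarrow> length p \<le> length q"
    using ex_has_least_nat[of Q _ length] by metis
  then have walk: "vwalk p ?G" and dist: "distinct p" and hd: "hd p \<in> A" and last: "last p \<in> B"
    and sub: "set p \<subseteq> ?U" and ne: "p \<noteq> []"
    by (auto simp: Q_def)
  have V: "set p \<subseteq> V" using walk by (auto simp: vwalk_def)
  define n where "n = length p - 1"
  have len: "length p = Suc n" using ne by (cases p) (simp_all add: n_def)
  have hd': "p ! 0 \<in> A" and last': "p ! n \<in> B"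
    using hd last ne by (simp_all add: hd_conv_nth last_conv_nth n_def)
  show thesis
  proof
    show "1 \<le> n" using hd' last' disj by (cases n) auto
    show "inj_on ((!) p) {..n}" using dist len by (auto simp: inj_on_def nth_eq_iff_index_eq)
    show "(!) p ` {..n} \<subseteq> V" using V len nth_mem[of _ p] by fastforce
    show "(!) p ` {1..<n} \<subseteq> C"
    proof (rule image_subsetI)
      fix i assume i: "i \<in> {1..<n}"
      then have "p ! i \<in> ?U" using len by (intro subsetD[OF sub] nth_mem) simp
      \<comment> \<open>An interior vertex in \<open>A\<close> would start a shorter witness, namely
        a proper suffix; one in \<open>B\<close> would end a proper prefix.\<close>
      moreover have "p ! i \<notin> A"
      proof
        assume "p ! i \<in> A"
        moreover have "vwalk (drop i p) ?G"
          using vwalkI_append_r[of "drop i p" "take i p"] walk i len by simp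
        ultimately have "Q (drop i p)"
          using i len dist last sub set_drop_subset[of i p]
          by (auto simp: Q_def vpath_def hd_drop_conv_nth)
        from min[OF this] show False using i len by auto
      qed
      moreover have "p ! i \<notin> B"
      proof
        assume "p ! i \<in> B"
        moreover have "vwalk (take (Suc i) p) ?G"
          using vwalkI_append_l[of "take (Suc i) p" "drop (Suc i) p"] walk ne by simp
        ultimately have "Q (take (Suc i) p)"
          using i len dist hd ne sub set_take_subset[of "Suc i" p] distinct_take[of p "Suc i"]
            last_snoc[of "take i p" "p ! i"] take_Suc_conv_app_nth[of i p]
          by (auto simp: Q_def vpath_def)
        from min[OF this] show False using i len by auto
      qed
      ultimately show "p ! i \<in> C" by blast
    qed
    show "K (p ! i) (p ! Suc i) \<noteq> 0" if "i < n" for i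
      using vwalk_nth_arc[OF walk, of i] that len by auto
    \<comment> \<open>Since \<open>i + 1 < j\<close>, a chord would bypass at least one vertex while
      keeping both ends, again giving a shorter witness.\<close>
    show "K (p ! i) (p ! j) = 0" if ij: "i + 1 < j" "j \<le> n" for i j
    proof (rule ccontr)
      assume "K (p ! i) (p ! j) \<noteq> 0"
      moreover have "p ! i \<in> V" "p ! j \<in> V" using V ij len by auto
      moreover have "p ! i \<noteq> p ! j" using dist ij len by (simp add: nth_eq_iff_index_eq)
      ultimately have "vwalk (take (Suc i) p @ drop j p) ?G"
        using walk ij len by (intro vwalk_take_drop) auto
      moreover have "distinct (take (Suc i) p @ drop j p)"
        using dist ij set_take_disj_set_drop_if_distinct[of p "Suc i" j] by auto
      ultimately have "Q (take (Suc i) p @ drop j p)"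
        using hd last ne sub ij len set_take_subset[of "Suc i" p] set_drop_subset[of j p]
        by (auto simp: Q_def vpath_def)
      from min[OF this] show False using ij len by auto
    qed
  qed (use hd' last' in auto)
qed

section \<open>Conditional independence on discrete spaces and independence models\<close>

text \<open>Clearing denominators removes the positivity condition on \<open>c\<close>: if the
  conditioning event is null, then so is each event contained in it, and both sides are 0.\<close>

lemma cond_indep_iff_product:
  fixes P :: "('a \<Rightarrow> nat) measure"
  assumes fin: "finite_measure P" and dsc: "sets P = Pow (space P)"
  shows "cond_indep P A B C \<longleftrightarrow> (\<forall>a b c.
    \<P>(x in P. restrict x C = c) *
      \<P>(x in P. restrict x A = a \<and> restrict x B = b \<and> restrict x C = c) =
    \<P>(x in P. restrict x A = a \<and> restrict x C = c) *
      \<P>(x in P. restrict x B = b \<and> restrict x C = c))"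
    (is "_ \<longleftrightarrow> (\<forall>a b c. ?p c * ?pab a b c = ?pa a c * ?pb b c)")
proof -
  interpret finite_measure P by fact
  have "(0 < ?p c \<longrightarrow> ?pab a b c / ?p c = ?pa a c / ?p c * (?pb b c / ?p c)) \<longleftrightarrow>
      ?p c * ?pab a b c = ?pa a c * ?pb b c" for a b c
  proof (cases "?p c = 0")
    case True
    have "?pa a c \<le> ?p c"
      by (rule finite_measure_mono) (auto simp: dsc)
    then have "?pa a c = 0" using True by (simp add: measure_le_0_iff)
    with True show ?thesis by simp
  next
    case False
    then have "0 < ?p c" by (simp add: zero_less_measure_iff)
    then show ?thesis by (auto simp: field_simps power2_eq_square)
  qed
  then show ?thesis by (simp add: cond_indep_def cond_prob_def conj_assoc)
qed

lemma cond_indep_commute: "cond_indep P A B C \<longleftrightarrow> cond_indep P B A C"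
proof -
  have "cond_indep P B A C" if "cond_indep P A B C" for A B
    using that unfolding cond_indep_def
    by (subst conj_commute, subst mult.commute) blast
  then show ?thesis by blast
qed

text \<open>Marginalisation: the event is the disjoint union over the attained values of the larger
  subvector that restrict to \<open>a'\<close>.\<close>

lemma measure_restrict_subset:
  fixes P :: "('a \<Rightarrow> nat) measure"
  assumes fin: "finite (space P)" and meas: "finite_measure P" and dsc: "sets P = Pow (space P)"
    and sub: "A' \<subseteq> A"
  shows "\<P>(x in P. restrict x A' = a' \<and> R x) =
    (\<Sum>a | a \<in> (\<lambda>x. restrict x A) ` space P \<and> restrict a A' = a'.
      \<P>(x in P. restrict x A = a \<and> R x))"
    (is "_ = (\<Sum>a\<in>?F. measure P (?E a))")
proof -
  interpret finite_measure P by fact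
  have eq: "restrict a A' = restrict x A'" if "restrict x A = a" for x a :: "'a \<Rightarrow> nat"
    using that sub by (auto simp: Int_absorb1)
  have "{x \<in> space P. restrict x A' = a' \<and> R x} = (\<Union>a\<in>?F. ?E a)"
  proof (intro subset_antisym subsetI)
    fix x assume "x \<in> {x \<in> space P. restrict x A' = a' \<and> R x}"
    then have "restrict x A \<in> ?F" "x \<in> ?E (restrict x A)"
      using eq[OF refl, of x] by simp_all
    then show "x \<in> (\<Union>a\<in>?F. ?E a)" by blast
  next
    fix x assume "x \<in> (\<Union>a\<in>?F. ?E a)"
    then obtain a where "a \<in> ?F" "x \<in> ?E a" by blast
    then show "x \<in> {x \<in> space P. restrict x A' = a' \<and> R x}"
      using eq[of x a] by simp
  qed
  moreover have "measure P (\<Union>a\<in>?F. ?E a) = (\<Sum>a\<in>?F. measure P (?E a))"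
    by (rule finite_measure_finite_Union) (use fin in \<open>auto simp: dsc disjoint_family_on_def\<close>)
  ultimately show ?thesis by simp
qed

text \<open>Both sides of the product form are linear in the probabilities of the
  \<open>A\<close>-events, so summing it over the extensions of a value on \<open>A'\<close> gives
  the claim.\<close>

lemma cond_indep_subset_left:
  assumes fin: "finite (space P)" and meas: "finite_measure P" and dsc: "sets P = Pow (space P)"
    and sub: "A' \<subseteq> A" and ci: "cond_indep P A B C"
  shows "cond_indep P A' B C"
  using ci
  by (simp add: cond_indep_iff_product[OF meas dsc] measure_restrict_subset[OF fin meas dsc sub]
      sum_distrib_left sum_distrib_right)

lemma cond_indep_subset:
  assumes fin: "finite (space P)" and meas: "finite_measure P" and dsc: "sets P = Pow (space P)"
    and sub: "A' \<subseteq> A" "B' \<subseteq> B" and ci: "cond_indep P A B C"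
  shows "cond_indep P A' B' C"
  using cond_indep_subset_left[OF fin meas dsc] sub ci cond_indep_commute by metis

text \<open>Downward-stability deletes one vertex at a time; induction on the deleted set
  \<open>S\<close> reaches any subset of \<open>C\<close>.\<close>

lemma downward_stable_subset:
  assumes ds: "downward_stable V J" and ij: "i \<in> V" "j \<in> V" "i \<noteq> j" and C: "C \<subseteq> V - {i, j}"
    and fin: "finite C" and J: "({i}, {j}, C) \<in> J" and D: "D \<subseteq> C"
  shows "({i}, {j}, D) \<in> J"
proof -
  have "finite S \<Longrightarrow> S \<subseteq> C \<Longrightarrow> ({i}, {j}, C - S) \<in> J" for S
  proof (induction S rule: finite_induct)
    case empty
    then show ?case using J by simp
  next
    case (insert k S)
    moreover have "C - S \<subseteq> V - {i, j}" "k \<in> V - {i, j}" using insert.prems C by auto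
    ultimately have "({i}, {j}, C - S - {k}) \<in> J"
      using ds ij by (simp add: downward_stable_def)
    moreover have "C - insert k S = C - S - {k}" by blast
    ultimately show ?case by simp
  qed
  from this[of "C - D"] show ?thesis using D fin by (simp add: double_diff)
qed

section \<open>Events of the determinantal process and the two implications\<close>

context determinantal_process
begin

definition X :: "'w \<Rightarrow> 'a \<Rightarrow> nat" where
  "X w = binary_vector V (Y w)"

lemma X_apply: "v \<in> V \<Longrightarrow> X w v = (if v \<in> Y w then 1 else 0)"
  by (simp add: X_def binary_vector_def)

lemma X_measurable: "X \<in> M \<rightarrow>\<^sub>M count_space (V \<rightarrow>\<^sub>E {0, 1})"
proof -
  have "binary_vector V \<in> count_space (Pow V) \<rightarrow>\<^sub>M count_space (V \<rightarrow>\<^sub>E {0, 1})"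
    by (auto simp: binary_vector_def)
  from measurable_compose[OF random_subset this] show ?thesis
    by (simp add: X_def[abs_def])
qed

lemma prob_binary_distr: "\<P>(x in binary_distr M V Y. Q x) = \<P>(w in M. Q (X w))"
proof -
  have "binary_distr M V Y = distr M (count_space (V \<rightarrow>\<^sub>E {0, 1})) X"
    by (simp add: binary_distr_def X_def[abs_def])
  moreover have "X w \<in> V \<rightarrow>\<^sub>E {0, 1}" if "w \<in> space M" for w
    using measurable_space[OF X_measurable that] by (simp only: space_count_space)
  moreover from this have "X -` {x \<in> V \<rightarrow>\<^sub>E {0, 1}. Q x} \<inter> space M = {w \<in> space M. Q (X w)}"
    by blast
  ultimately show ?thesis
    using measure_distr[OF X_measurable, of "{x \<in> V \<rightarrow>\<^sub>E {0, 1}. Q x}"] by simp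
qed

lemma binary_distr_discrete:
  "finite (space (binary_distr M V Y))" "finite_measure (binary_distr M V Y)"
  "sets (binary_distr M V Y) = Pow (space (binary_distr M V Y))"
proof -
  show "finite (space (binary_distr M V Y))"
    using finite_ground by (simp add: binary_distr_def finite_PiE)
  show "finite_measure (binary_distr M V Y)"
    using X_measurable unfolding binary_distr_def X_def[abs_def] by (rule finite_measure_distr)
qed (simp add: binary_distr_def)

lemma cond_indep_binary_distr:
  "cond_indep (binary_distr M V Y) A B C \<longleftrightarrow> (\<forall>a b c.
    \<P>(w in M. restrict (X w) C = c) *
      \<P>(w in M. restrict (X w) A = a \<and> restrict (X w) B = b \<and> restrict (X w) C = c) =
    \<P>(w in M. restrict (X w) A = a \<and> restrict (X w) C = c) *
      \<P>(w in M. restrict (X w) B = b \<and> restrict (X w) C = c))"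
  unfolding cond_indep_iff_product[OF binary_distr_discrete(2,3)] prob_binary_distr ..

text \<open>This adds the empty set, where both sides are 1, to \<open>inclusion_prob\<close>. It
  covers an empty conditioning set and the trivial inclusion event.\<close>

lemma prob_superset: "S \<subseteq> V \<Longrightarrow> \<P>(w in M. S \<subseteq> Y w) = principal_minor K S"
  using inclusion_prob[of S] prob_space by (cases "S = {}") (simp_all add: principal_minor_def)

lemma superset_event: "{w \<in> space M. S \<subseteq> Y w} \<in> events"
proof -
  have "Y -` {T \<in> Pow V. S \<subseteq> T} \<inter> space M \<in> events"
    using random_subset by (rule measurable_sets) auto
  moreover have "Y -` {T \<in> Pow V. S \<subseteq> T} \<inter> space M = {w \<in> space M. S \<subseteq> Y w}"
    using measurable_space[OF random_subset] by auto
  ultimately show ?thesis by simp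
qed

text \<open>For \<open>W\<close> inside \<open>V\<close>, these are the events whose probabilities
  the kernel gives directly. They form a \<pi>-system, and the \<sigma>-algebra they generate
  contains every event that fixes the values of \<open>X\<close> on a subset of
  \<open>W\<close>.\<close>

definition inclusion_events :: "'a set \<Rightarrow> 'w set set" where
  "inclusion_events W = (\<lambda>S. {w \<in> space M. S \<subseteq> Y w}) ` Pow W"

lemma sets_sigma_inclusion_events:
  "sets (sigma (space M) (inclusion_events W)) = sigma_sets (space M) (inclusion_events W)"
  by (rule sets_measure_of) (auto simp: inclusion_events_def)

lemma restrict_event:
  assumes "A \<subseteq> W" "W \<subseteq> V"
  shows "{w \<in> space M. restrict (X w) A = a} \<in> sigma_sets (space M) (inclusion_events W)"
proof -
  let ?N = "sigma (space M) (inclusion_events W)"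
  have finA: "finite A" using assms finite_ground by (meson finite_subset)
  have space: "space ?N = space M" by (simp add: space_measure_of_conv)
  have mem: "{w \<in> space ?N. v \<in> Y w} \<in> sets ?N" if "v \<in> W" for v
  proof -
    have "{w \<in> space M. {v} \<subseteq> Y w} \<in> inclusion_events W"
      unfolding inclusion_events_def using that by blast
    then show ?thesis
      unfolding sets_sigma_inclusion_events space by (auto intro: sigma_sets.Basic)
  qed
  have "{w \<in> space ?N. X w v = a v} \<in> sets ?N" if "v \<in> A" for v
  proof -
    \<comment> \<open>The value 0 comes from complements of inclusion events; any value
      \<open>a v\<close> other than 0 and 1 gives the empty event.\<close>
    have "{w \<in> space ?N. (v \<in> Y w \<and> a v = 1) \<or> (\<not> v \<in> Y w \<and> a v = 0)} \<in> sets ?N"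
      using mem[of v] that assms
      by (intro sets.sets_Collect_disj sets.sets_Collect_conj sets.sets_Collect_neg
          sets.sets_Collect_const) auto
    moreover have "X w v = a v \<longleftrightarrow> (v \<in> Y w \<and> a v = 1) \<or> (\<not> v \<in> Y w \<and> a v = 0)" for w
      using that assms by (subst X_apply) auto
    ultimately show ?thesis by simp
  qed
  then have "{w \<in> space ?N. a \<in> extensional A \<and> (\<forall>v\<in>A. X w v = a v)} \<in> sets ?N"
    using finA by (intro sets.sets_Collect_conj sets.sets_Collect_finite_All
        sets.sets_Collect_const) auto
  moreover have "restrict (X w) A = a \<longleftrightarrow> a \<in> extensional A \<and> (\<forall>v\<in>A. X w v = a v)" for w
    by (auto simp: fun_eq_iff extensional_def restrict_def)
  ultimately show ?thesis by (simp add: sets_sigma_inclusion_events space)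
qed

lemma Int_stable_inclusion_events: "Int_stable (inclusion_events W)"
proof (rule Int_stableI)
  fix E F assume "E \<in> inclusion_events W" "F \<in> inclusion_events W"
  then obtain S T where "S \<subseteq> W" "T \<subseteq> W" "E = {w \<in> space M. S \<subseteq> Y w}"
    "F = {w \<in> space M. T \<subseteq> Y w}"
    by (auto simp: inclusion_events_def)
  then show "E \<inter> F \<in> inclusion_events W"
    unfolding inclusion_events_def by (intro image_eqI[of _ _ "S \<union> T"]) auto
qed

text \<open>On the generators, independence is the factorisation of the minor of
  \<open>S1 \<union> S2\<close> into two blocks. Stability under intersection extends it to the
  generated \<sigma>-algebras.\<close>

lemma indep_blocks:
  assumes W: "W1 \<subseteq> V" "W2 \<subseteq> V" "W1 \<inter> W2 = {}"
    and zero: "\<And>i j. i \<in> W1 \<Longrightarrow> j \<in> W2 \<Longrightarrow> K i j = 0"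
  shows "indep_set (sigma_sets (space M) (inclusion_events W1))
    (sigma_sets (space M) (inclusion_events W2))"
proof (rule indep_set_sigma_sets)
  show "indep_set (inclusion_events W1) (inclusion_events W2)"
  proof (rule indep_setI)
    show "inclusion_events W1 \<subseteq> events" "inclusion_events W2 \<subseteq> events"
      by (auto simp: inclusion_events_def superset_event)
    fix E1 E2 assume "E1 \<in> inclusion_events W1" "E2 \<in> inclusion_events W2"
    then obtain S1 S2 where S: "S1 \<subseteq> W1" "S2 \<subseteq> W2"
      and E: "E1 = {w \<in> space M. S1 \<subseteq> Y w}" "E2 = {w \<in> space M. S2 \<subseteq> Y w}"
      by (auto simp: inclusion_events_def)
    have "E1 \<inter> E2 = {w \<in> space M. S1 \<union> S2 \<subseteq> Y w}" using E by auto
    moreover have "principal_minor K (S1 \<union> S2) = principal_minor K S1 * principal_minor K S2"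
    proof (rule principal_minor_block_triangular)
      show "finite S1" "finite S2" "S1 \<inter> S2 = {}"
        using S W finite_ground finite_subset[of S1 V] finite_subset[of S2 V] by auto
      show "K i j = 0" if "i \<in> S1" "j \<in> S2" for i j
        using S zero that by blast
    qed
    moreover have "S1 \<subseteq> V" "S2 \<subseteq> V" "S1 \<union> S2 \<subseteq> V" using S W by auto
    ultimately show "prob (E1 \<inter> E2) = prob E1 * prob E2"
      by (simp only: E prob_superset)
  qed
qed (rule Int_stable_inclusion_events)+

text \<open>
  Separation splits \<open>A \<union> B \<union> C\<close> into two uncoupled blocks. The conditioning set splits along with it,
  so all four probabilities in the product form of conditional independence factorise.
\<close>

lemma separated_imp_cond_indep:
  assumes sep: "separated (bidirected_graph V K) A B C" and sub: "A \<union> B \<union> C \<subseteq> V"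
    and disj: "A \<inter> B = {}"
  shows "cond_indep (binary_distr M V Y) A B C"
proof -
  obtain W where W: "A \<subseteq> W" "W \<subseteq> A \<union> B \<union> C" "W \<inter> B = {}"
    and zero: "\<And>i j. i \<in> W \<Longrightarrow> j \<in> A \<union> B \<union> C - W \<Longrightarrow> K i j = 0"
    using separated_block[OF sep sub disj] by blast
  \<comment> \<open>\<open>W'\<close> contains \<open>B\<close>, and \<open>C\<close> is cut into
    its part \<open>C1\<close> on the side of \<open>A\<close> and its part \<open>C2\<close> on the
    side of \<open>B\<close>.\<close>
  define W' where "W' = A \<union> B \<union> C - W"
  define C1 where "C1 = C \<inter> W"
  define C2 where "C2 = C \<inter> W'"
  have V: "W \<subseteq> V" "W' \<subseteq> V" using W sub by (auto simp: W'_def)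
  have indep: "indep_set (sigma_sets (space M) (inclusion_events W))
      (sigma_sets (space M) (inclusion_events W'))"
    by (rule indep_blocks) (use V zero in \<open>auto simp: W'_def\<close>)
  show ?thesis
    unfolding cond_indep_binary_distr
  proof (intro allI)
    fix a b c :: "'a \<Rightarrow> nat"
    let ?E = "\<lambda>S s. {w \<in> space M. restrict (X w) S = s}"
    let ?c1 = "restrict c C1" and ?c2 = "restrict c C2"
    have ev: "?E A a \<in> sigma_sets (space M) (inclusion_events W)"
        "?E C1 ?c1 \<in> sigma_sets (space M) (inclusion_events W)"
        "?E B b \<in> sigma_sets (space M) (inclusion_events W')"
        "?E C2 ?c2 \<in> sigma_sets (space M) (inclusion_events W')"
      by (rule restrict_event; use W V in \<open>auto simp: C1_def C2_def W'_def\<close>)+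
    have ev': "?E A a \<inter> ?E C1 ?c1 \<in> sigma_sets (space M) (inclusion_events W)"
        "?E B b \<inter> ?E C2 ?c2 \<in> sigma_sets (space M) (inclusion_events W')"
      using ev unfolding sets_sigma_inclusion_events[symmetric] by blast+
    have C: "C = C1 \<union> C2" by (auto simp: C1_def C2_def W'_def)
    \<comment> \<open>A value \<open>c\<close> that is not extensional on \<open>C\<close> is never
      attained, so all events involving it are empty.\<close>
    have split: "restrict (X w) C = c \<longleftrightarrow>
        c \<in> extensional C \<and> restrict (X w) C1 = ?c1 \<and> restrict (X w) C2 = ?c2" for w
      unfolding C by (auto simp: fun_eq_iff extensional_def restrict_def)
    show "\<P>(w in M. restrict (X w) C = c) *
        \<P>(w in M. restrict (X w) A = a \<and> restrict (X w) B = b \<and> restrict (X w) C = c) =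
      \<P>(w in M. restrict (X w) A = a \<and> restrict (X w) C = c) *
        \<P>(w in M. restrict (X w) B = b \<and> restrict (X w) C = c)"
    proof (cases "c \<in> extensional C")
      case True
      \<comment> \<open>After factorisation both sides are the product of the same four
        probabilities: those of \<open>C1\<close>, of \<open>C2\<close>, of \<open>A\<close> with
        \<open>C1\<close>, and of \<open>B\<close> with \<open>C2\<close>.\<close>
      have "?E C c = ?E C1 ?c1 \<inter> ?E C2 ?c2"
        "{w \<in> space M. restrict (X w) A = a \<and> restrict (X w) B = b \<and> restrict (X w) C = c} =
          (?E A a \<inter> ?E C1 ?c1) \<inter> (?E B b \<inter> ?E C2 ?c2)"
        "{w \<in> space M. restrict (X w) A = a \<and> restrict (X w) C = c} =
          (?E A a \<inter> ?E C1 ?c1) \<inter> ?E C2 ?c2"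
        "{w \<in> space M. restrict (X w) B = b \<and> restrict (X w) C = c} =
          ?E C1 ?c1 \<inter> (?E B b \<inter> ?E C2 ?c2)"
        using True by (auto simp: split)
      then show ?thesis
        using ev ev' by (simp add: indep_setD[OF indep])
    qed (simp add: split)
  qed
qed

text \<open>At the all-ones values each event in the product form becomes an inclusion event, whose
  probability is a principal minor.\<close>

lemma cond_indep_imp_minors:
  assumes ij: "i \<in> V" "j \<in> V" and D: "D \<subseteq> V"
    and ci: "cond_indep (binary_distr M V Y) {i} {j} D"
  shows "principal_minor K D * principal_minor K (insert i (insert j D)) =
    principal_minor K (insert i D) * principal_minor K (insert j D)"
proof -
  have "restrict (X w) S = (\<lambda>v\<in>S. 1) \<longleftrightarrow> S \<subseteq> Y w" if "S \<subseteq> V" for w S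
  proof -
    have "restrict (X w) S = (\<lambda>v\<in>S. 1) \<longleftrightarrow> (\<forall>v\<in>S. X w v = 1)"
      by (auto simp: fun_eq_iff restrict_def)
    then show ?thesis using that by (auto simp: X_apply subset_iff)
  qed
  then have "\<P>(w in M. D \<subseteq> Y w) * \<P>(w in M. {i} \<subseteq> Y w \<and> {j} \<subseteq> Y w \<and> D \<subseteq> Y w) =
      \<P>(w in M. {i} \<subseteq> Y w \<and> D \<subseteq> Y w) * \<P>(w in M. {j} \<subseteq> Y w \<and> D \<subseteq> Y w)"
    using ci[unfolded cond_indep_binary_distr, rule_format,
        of "\<lambda>v\<in>D. 1" "\<lambda>v\<in>{i}. 1" "\<lambda>v\<in>{j}. 1"] ij D
    by simp
  then show ?thesis
    using ij D prob_superset[of D] prob_superset[of "insert i D"] prob_superset[of "insert j D"]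
      prob_superset[of "insert i (insert j D)"]
    by simp
qed

lemma cond_indep_imp_separated:
  assumes ds: "downward_stable V (indep_model V (binary_distr M V Y))"
    and tr: "(A, B, C) \<in> indep_model V (binary_distr M V Y)"
  shows "separated (bidirected_graph V K) A B C"
proof (rule ccontr)
  assume nsep: "\<not> separated (bidirected_graph V K) A B C"
  have disj: "A \<inter> B = {}" "A \<inter> C = {}" "B \<inter> C = {}" and sub: "A \<subseteq> V" "B \<subseteq> V" "C \<subseteq> V"
    and ci: "cond_indep (binary_distr M V Y) A B C"
    using tr by (auto simp: indep_model_def disjoint_triples_def)
  obtain w :: "nat \<Rightarrow> 'a" and n where n: "1 \<le> n" and inj: "inj_on w {..n}" and V: "w ` {..n} \<subseteq> V"
    and ends: "w 0 \<in> A" "w n \<in> B" and inner: "w ` {1..<n} \<subseteq> C"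
    and adj: "\<And>i. i < n \<Longrightarrow> K (w i) (w (Suc i)) \<noteq> 0"
    and chordless: "\<And>i j. i + 1 < j \<Longrightarrow> j \<le> n \<Longrightarrow> K (w i) (w j) = 0"
    by (rule not_separated_chordless_path[OF nsep disj(1)]) (rule that)
  let ?D = "w ` {1..<n}"
  have sym: "K (w i) (w j) = K (w j) (w i)" if "i \<le> n" "j \<le> n" for i j
    using kernel_sym V that unfolding sym_on_def by (auto simp: image_subset_iff)
  \<comment> \<open>Downward-stability concerns single vertices only, so \<open>A\<close> and
    \<open>B\<close> are first shrunk to the ends of the path.\<close>
  have "cond_indep (binary_distr M V Y) {w 0} {w n} C"
    using cond_indep_subset[OF binary_distr_discrete _ _ ci] ends by simp
  then have "({w 0}, {w n}, C) \<in> indep_model V (binary_distr M V Y)"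
    using ends disj sub by (auto simp: indep_model_def disjoint_triples_def)
  then have "({w 0}, {w n}, ?D) \<in> indep_model V (binary_distr M V Y)"
  proof (rule downward_stable_subset[OF ds, rotated 5])
    show "w 0 \<in> V" "w n \<in> V" "C \<subseteq> V - {w 0, w n}" "w 0 \<noteq> w n"
      using ends disj sub by auto
    show "finite C" using sub(3) finite_ground by (rule finite_subset)
  qed (rule inner)
  then have "principal_minor K ?D * principal_minor K (insert (w 0) (insert (w n) ?D)) =
    principal_minor K (insert (w 0) ?D) * principal_minor K (insert (w n) ?D)"
    using ends sub inner by (intro cond_indep_imp_minors) (auto simp: indep_model_def)
  moreover have "insert 0 {1..<n} = {0..<n}" "insert n {1..<n} = {1..<Suc n}"
    "insert 0 {1..<Suc n} = {0..<Suc n}"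
    using n by auto
  then have "insert (w 0) ?D = w ` {0..<n}" "insert (w n) ?D = w ` {1..<Suc n}"
    "insert (w 0) (w ` {1..<Suc n}) = w ` {0..<Suc n}"
    by (metis image_insert)+
  \<comment> \<open>The relation between the minors says that the left side of
    \<open>principal_minor_tridiagonal\<close> is 0.\<close>
  ultimately have "(\<Prod>i<n. K (w i) (w (Suc i)) * K (w (Suc i)) (w i)) = 0"
    using principal_minor_tridiagonal[of w n K] inj n chordless sym by (simp add: mult.commute)
  moreover have "K (w i) (w (Suc i)) * K (w (Suc i)) (w i) \<noteq> 0" if "i < n" for i
    using adj[OF that] sym[of i "Suc i"] that by simp
  ultimately show False by simp
qed

end

theorem proposition5:
  fixes M :: "'w measure" and V :: "'a set" and K :: "'a \<Rightarrow> 'a \<Rightarrow> real"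
    and Y :: "'w \<Rightarrow> 'a set" and P :: "('a \<Rightarrow> nat) measure"
  assumes "determinantal_process M V K Y"
    and "P = binary_distr M V Y"
  shows "faithful V P (bidirected_graph V K) \<longleftrightarrow> downward_stable V (indep_model V P)"
proof -
  interpret determinantal_process M V K Y by fact
  show ?thesis
  proof
    assume faithful: "faithful V P (bidirected_graph V K)"
    have iff: "separated (bidirected_graph V K) A B C \<longleftrightarrow> (A, B, C) \<in> indep_model V P"
      if "(A, B, C) \<in> disjoint_triples V" "A \<noteq> {}" "B \<noteq> {}" for A B C
      using bspec[OF faithful[unfolded faithful_def] that(1)] that by simp
    show "downward_stable V (indep_model V P)"
      unfolding downward_stable_def
    proof (intro ballI allI impI)
      fix i j C k
      assume *: "i \<in> V" "j \<in> V" "i \<noteq> j" "C \<subseteq> V - {i, j}" "({i}, {j}, C) \<in> indep_model V P"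
      then have triples: "({i}, {j}, C) \<in> disjoint_triples V" "({i}, {j}, C - {k}) \<in> disjoint_triples V"
        by (auto simp: disjoint_triples_def)
      then have "separated (bidirected_graph V K) {i} {j} C"
        using * by (simp add: iff)
      \<comment> \<open>Shrinking \<open>C\<close> only enlarges the set of vertices outside the
        union, so every path that was blocked stays blocked.\<close>
      then have "separated (bidirected_graph V K) {i} {j} (C - {k})"
        unfolding separated_def by blast
      then show "({i}, {j}, C - {k}) \<in> indep_model V P"
        using triples by (simp add: iff)
    qed
  next
    assume "downward_stable V (indep_model V P)"
    then have ds: "downward_stable V (indep_model V (binary_distr M V Y))"
      using assms(2) by simp
    have "separated (bidirected_graph V K) A B C \<longleftrightarrow> (A, B, C) \<in> indep_model V P"
      if tr: "(A, B, C) \<in> disjoint_triples V" for A B C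
    proof
      assume "separated (bidirected_graph V K) A B C"
      then have "cond_indep P A B C"
        unfolding assms(2)
        by (rule separated_imp_cond_indep) (use tr in \<open>auto simp: disjoint_triples_def\<close>)
      with tr show "(A, B, C) \<in> indep_model V P" by (simp add: indep_model_def)
    qed (use cond_indep_imp_separated[OF ds] assms(2) in simp)
    then show "faithful V P (bidirected_graph V K)"
      by (auto simp: faithful_def)
  qed
qed

end
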